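(* Let $F$ be a labeled plane figure over a finite alphabet $\Sigma$, and let $A$ and $B$ be nonempty rectangular arrays over $\Sigma$. Suppose $F$ has two different tilings $U$ and $V$ by the set $\{A, B\}$. Then both $A$ and $B$ are powers of a third array $C$, i.e., there exist a nonempty array $C$ and positive integers $p_1,q_1,p_2,q_2$ with $A = C^{p_1\times q_1}$ and $B = C^{p_2\times q_2}$.
   Context: A labeled plane figure is a map from a finite subset $D \subseteq \mathbb{Z}\times\mathbb{Z}$ (its cells) to $\Sigma$; it need not be connected or convex. An $m\times n$ array $M$ (entries $M[i,j]$, $0\le i<m$, $0\le j<n$) placed at translate $(a,b)\in\mathbb{Z}^2$ occupies the cells $(a+i,b+j)$ carrying labels $M[i,j]$ (no rotations or reflections). For a finite set $S$ of rectangular arrays, a tiling of $F$ by $S$ is a finite collection of translates of arrays from $S$ such that the occupied cells of distinct placed tiles are pairwise disjoint, their union is exactly $D$, and each cell of $D$ is covered by an entry equal to its label. Two tilings are different if they are different as collections of placed (translated) tiles. For $A\in\Sigma^{m\times n}$ and positive integers $p,q$, $A^{p\times q}$ is the $pm \times qn$ array $B$ with $B[i,j] = A[i \bmod m, j \bmod n]$. *)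

theory Defs
  imports "Jordan_Normal_Form.Matrix"
begin

text \<open>Rectangular arrays are the matrices \<^typ>\<open>'a mat\<close>: dimensions together with entries indexed
  from \<open>0\<close>, with extensional equality. The alphabet is the element type.\<close>

definition nonempty_array :: "'a mat \<Rightarrow> bool" where
  "nonempty_array M \<longleftrightarrow> 0 < dim_row M \<and> 0 < dim_col M"

definition array_power :: "'a mat \<Rightarrow> nat \<Rightarrow> nat \<Rightarrow> 'a mat" where
  "array_power A p q =
     mat (p * dim_row A) (q * dim_col A) (\<lambda>(i, j). A $$ (i mod dim_row A, j mod dim_col A))"

text \<open>The domain of the partial map is the set of cells of the figure.\<close>

type_synonym 'a figure = "int \<times> int \<rightharpoonup> 'a"

definition plane_figure :: "'a figure \<Rightarrow> bool" where
  "plane_figure F \<longleftrightarrow> finite (dom F)"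

type_synonym 'a placed_tile = "'a mat \<times> (int \<times> int)"

fun cells :: "'a placed_tile \<Rightarrow> (int \<times> int) set" where
  "cells (M, (a, b)) = {(a + int i, b + int j) | i j. i < dim_row M \<and> j < dim_col M}"

definition is_tiling :: "'a mat set \<Rightarrow> 'a figure \<Rightarrow> 'a placed_tile set \<Rightarrow> bool" where
  "is_tiling S F T \<longleftrightarrow>
     finite T \<and> fst ` T \<subseteq> S \<and>
     (\<forall>s\<in>T. \<forall>t\<in>T. s \<noteq> t \<longrightarrow> cells s \<inter> cells t = {}) \<and>
     (\<Union>t\<in>T. cells t) = dom F \<and>
     (\<forall>(M, (a, b))\<in>T. \<forall>i<dim_row M. \<forall>j<dim_col M. F (a + int i, b + int j) = Some (M $$ (i, j)))"

end

theory Submission imports Defs begin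

text \<open>Induction on the total width of \<open>A\<close> and \<open>B\<close>, where \<open>A\<close> is at most as wide as \<open>B\<close>. After the
  common tiles of \<open>U\<close> and \<open>V\<close> are removed, the topmost cell of the leftmost column is the corner of
  an \<open>A\<close> in one tiling and of a \<open>B\<close> in the other. All tiles meeting the vertical run of cells below
  it start in that column, so the run gives two factorizations of one word over \<open>{u, v}\<close> with
  different first factors, where \<open>u\<close> and \<open>v\<close> are the words formed by the rows of \<open>A\<close> and \<open>B\<close>
  truncated to the width of \<open>A\<close>. Hence \<open>u\<close> and \<open>v\<close> commute and are powers of a common word: \<open>A\<close> is a
  vertical stack of copies of an array \<open>X\<close>, and \<open>B\<close> is such a stack followed on the right by a
  remainder \<open>D\<close>. Cutting all tiles accordingly gives two tilings by \<open>{X, D}\<close>, which differ because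
  the copies of \<open>D\<close> record the positions of the copies of \<open>B\<close>. A common root of \<open>X\<close> and \<open>D\<close> is one
  of \<open>A\<close> and \<open>B\<close>.\<close>

section \<open>Combinatorics on words: a nontrivial relation forces commutation\<close>

text \<open>Euclid's algorithm on words: the shorter first factor is a prefix of the longer one, and
  splitting that prefix off the longer word gives a relation of the same shape with smaller total
  length.\<close>

lemma two_word_relation_commute:
  fixes u v :: "'a list"
  assumes "u @ concat xs = v @ concat ys" "set xs \<subseteq> {u, v}" "set ys \<subseteq> {u, v}" "u \<noteq> []" "v \<noteq> []"
  shows "u @ v = v @ u"
  using assms
proof (induction "length u + length v" arbitrary: u v xs ys rule: less_induct)
  case less
  \<comment> \<open>Stated for fresh words of the same total length, so that it applies to
    \<open>u\<close>, \<open>v\<close> in either order.\<close>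
  have step: "s @ t = t @ s"
    if eq: "s @ concat xs = t @ concat ys" and sub: "set xs \<subseteq> {s, t}" "set ys \<subseteq> {s, t}"
      and ne: "s \<noteq> []" "t \<noteq> []" and le: "length s \<le> length t"
      and len: "length s + length t = length u + length v"
    for s t :: "'a list" and xs ys
  proof -
    obtain w where t: "t = s @ w"
      using eq le by (metis append_eq_append_conv_if append_eq_conv_conj)
    show ?thesis
    proof (cases "w = []")
      case True
      then show ?thesis using t by simp
    next
      case False
      \<comment> \<open>Each factor \<open>t\<close> is replaced by \<open>s\<close> followed by
        \<open>w\<close>. As \<open>s\<close> and \<open>t\<close> both begin with \<open>s\<close>,
        every nonempty factorization becomes one with first factor \<open>s\<close>; after one
        \<open>s\<close> is cancelled, this supplies the two different first factors
        \<open>s\<close> and \<open>w\<close>.\<close>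
      have refine: "\<exists>zs'. concat zs = concat zs' \<and> set zs' \<subseteq> {s, w} \<and> (zs \<noteq> [] \<longrightarrow> zs' \<noteq> [] \<and> hd zs' = s)"
        if "set zs \<subseteq> {s, t}" for zs
        using that
      proof (induction zs)
        case Nil
        show ?case by (rule exI[of _ "[]"]) simp
      next
        case (Cons z zs)
        then obtain zs' where zs': "concat zs = concat zs'" "set zs' \<subseteq> {s, w}" by auto
        show ?case
        proof (cases "z = s")
          case True
          then show ?thesis using zs' by (intro exI[of _ "s # zs'"]) simp
        next
          case False
          then have "z = t" using Cons.prems by auto
          then show ?thesis using zs' t by (intro exI[of _ "s # w # zs'"]) simp
        qed
      qed
      obtain xs' where xs': "concat xs = concat xs'" "set xs' \<subseteq> {s, w}" "xs \<noteq> [] \<longrightarrow> xs' \<noteq> [] \<and> hd xs' = s"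
        using refine[OF sub(1)] by blast
      obtain ys' where ys': "concat ys = concat ys'" "set ys' \<subseteq> {s, w}"
        using refine[OF sub(2)] by blast
      have eq': "concat xs = w @ concat ys" using eq t by simp
      then have "xs \<noteq> []" using False by auto
      then obtain xs'' where "xs' = s # xs''" using xs'(3) by (cases xs') auto
      then have "s @ concat xs'' = w @ concat ys'" "set xs'' \<subseteq> {s, w}"
        using eq' xs' ys' by auto
      moreover have "length s + length w < length u + length v"
        using len t ne by (cases s) auto
      ultimately have "s @ w = w @ s"
        using less.hyps ne False ys'(2) by metis
      then show ?thesis using t by simp
    qed
  qed
  show ?case
  proof (cases "length u \<le> length v")
    case True
    then show ?thesis using step less.prems by blast
  next
    case False
    have "v @ u = u @ v"
    proof (rule step)
      show "v @ concat ys = u @ concat xs" using less.prems(1) by simp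
      show "set ys \<subseteq> {v, u}" "set xs \<subseteq> {v, u}" using less.prems by auto
    qed (use less.prems False in auto)
    then show ?thesis by simp
  qed
qed

lemma nth_concat_replicate:
  "i < p * length z \<Longrightarrow> concat (replicate p z) ! i = z ! (i mod length z)"
proof (induction p arbitrary: i)
  case (Suc p)
  then show ?case
    by (cases "i < length z") (auto simp: nth_append le_mod_geq)
qed simp

section \<open>Tilings in terms of map inclusion: refinement and restriction\<close>

text \<open>A tile regarded as a figure of its own. The label condition becomes an inclusion of
  maps, and a dissection of one tile is again an instance of \<open>is_tiling\<close>.\<close>

definition tile_figure :: "'a placed_tile \<Rightarrow> 'a figure" where
  "tile_figure t = (\<lambda>(x, y). case t of (M, (a, b)) \<Rightarrow>
     if a \<le> x \<and> x < a + int (dim_row M) \<and> b \<le> y \<and> y < b + int (dim_col M)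
     then Some (M $$ (nat (x - a), nat (y - b))) else None)"

lemma mem_cells_iff:
  "(x, y) \<in> cells (M, (a, b)) \<longleftrightarrow>
     a \<le> x \<and> x < a + int (dim_row M) \<and> b \<le> y \<and> y < b + int (dim_col M)"
proof
  assume *: "a \<le> x \<and> x < a + int (dim_row M) \<and> b \<le> y \<and> y < b + int (dim_col M)"
  then show "(x, y) \<in> cells (M, (a, b))"
    unfolding cells.simps mem_Collect_eq
    by (intro exI[of _ "nat (x - a)"] exI[of _ "nat (y - b)"]) auto
qed auto

declare cells.simps [simp del]

lemma dom_tile_figure: "dom (tile_figure t) = cells t"
  by (cases t rule: cells.cases)
    (auto simp: tile_figure_def mem_cells_iff dom_def split: if_splits)

lemma tile_figure_le_iff:
  "tile_figure (M, (a, b)) \<subseteq>\<^sub>m F \<longleftrightarrow>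
     (\<forall>i<dim_row M. \<forall>j<dim_col M. F (a + int i, b + int j) = Some (M $$ (i, j)))"
  (is "?L \<longleftrightarrow> ?R")
proof
  assume L: ?L
  show ?R
  proof (intro allI impI)
    fix i j assume ij: "i < dim_row M" "j < dim_col M"
    then have "tile_figure (M, (a, b)) (a + int i, b + int j) = Some (M $$ (i, j))"
      by (simp add: tile_figure_def)
    then show "F (a + int i, b + int j) = Some (M $$ (i, j))"
      using L by (metis domI map_le_def)
  qed
next
  assume R: ?R
  show ?L
    unfolding map_le_def dom_tile_figure
  proof
    fix c assume "c \<in> cells (M, (a, b))"
    then obtain i j where "c = (a + int i, b + int j)" "i < dim_row M" "j < dim_col M"
      by (auto simp: cells.simps)
    then show "tile_figure (M, (a, b)) c = F c" using R by (simp add: tile_figure_def)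
  qed
qed

lemma is_tiling_iff:
  "is_tiling S F T \<longleftrightarrow>
     finite T \<and> fst ` T \<subseteq> S \<and>
     (\<forall>s\<in>T. \<forall>t\<in>T. s \<noteq> t \<longrightarrow> cells s \<inter> cells t = {}) \<and>
     (\<Union>t\<in>T. cells t) = dom F \<and> (\<forall>t\<in>T. tile_figure t \<subseteq>\<^sub>m F)"
proof -
  have "(\<forall>t\<in>T. tile_figure t \<subseteq>\<^sub>m F) \<longleftrightarrow>
    (\<forall>(M, (a, b))\<in>T. \<forall>i<dim_row M. \<forall>j<dim_col M. F (a + int i, b + int j) = Some (M $$ (i, j)))"
    by (intro ball_cong refl) (auto simp: tile_figure_le_iff split: prod.splits)
  then show ?thesis unfolding is_tiling_def by simp
qed

lemma
  assumes "is_tiling S F T"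
  shows is_tiling_finite: "finite T"
    and is_tiling_arrays: "fst ` T \<subseteq> S"
    and is_tiling_cover: "(\<Union>t\<in>T. cells t) = dom F"
    and is_tiling_tile_le: "t \<in> T \<Longrightarrow> tile_figure t \<subseteq>\<^sub>m F"
  using assms unfolding is_tiling_iff by simp_all

lemma is_tiling_disjoint:
  "is_tiling S F T \<Longrightarrow> s \<in> T \<Longrightarrow> t \<in> T \<Longrightarrow> c \<in> cells s \<Longrightarrow> c \<in> cells t \<Longrightarrow> s = t"
  unfolding is_tiling_iff by blast

lemma is_tiling_cells_subset: "is_tiling S F T \<Longrightarrow> t \<in> T \<Longrightarrow> cells t \<subseteq> dom F"
  unfolding is_tiling_iff by blast

lemma is_tiling_covers:
  assumes "is_tiling S F T" "c \<in> dom F"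
  obtains t where "t \<in> T" "c \<in> cells t"
  using assms unfolding is_tiling_iff by blast

lemma is_tiling_label:
  assumes "is_tiling S F T" "(M, (a, b)) \<in> T" "i < dim_row M" "j < dim_col M"
  shows "F (a + int i, b + int j) = Some (M $$ (i, j))"
  using is_tiling_tile_le[OF assms(1,2)] assms(3,4) unfolding tile_figure_le_iff by blast

text \<open>Pieces of one tile are disjoint by \<open>ref\<close>, pieces of different tiles because
  they stay inside their tiles; labels agree by transitivity of map inclusion.\<close>

lemma is_tiling_refine:
  assumes T: "is_tiling S F T"
    and ref: "\<And>t. t \<in> T \<Longrightarrow> is_tiling S' (tile_figure t) (R t)"
  shows "is_tiling S' F (\<Union>t\<in>T. R t)"
proof -
  have cov: "(\<Union>s\<in>R t. cells s) = cells t" if "t \<in> T" for t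
    using is_tiling_cover[OF ref[OF that]] by (simp only: dom_tile_figure)
  have "finite (\<Union>t\<in>T. R t)"
    using is_tiling_finite[OF T] is_tiling_finite[OF ref] by (rule finite_UN_I)
  moreover have "fst ` (\<Union>t\<in>T. R t) \<subseteq> S'"
    using is_tiling_arrays[OF ref] by blast
  moreover have "cells s \<inter> cells s' = {}"
    if "s \<in> R t" "s' \<in> R t'" "t \<in> T" "t' \<in> T" "s \<noteq> s'" for s s' t t'
  proof (cases "t = t'")
    case True
    then show ?thesis using that is_tiling_disjoint[OF ref[of t]] by blast
  next
    case False
    then have "cells t \<inter> cells t' = {}" using that is_tiling_disjoint[OF T] by blast
    then show ?thesis using cov that by blast
  qed
  moreover have "(\<Union>s\<in>(\<Union>t\<in>T. R t). cells s) = dom F"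
    using is_tiling_cover[OF T] cov by simp
  moreover have "tile_figure s \<subseteq>\<^sub>m F" if "s \<in> R t" "t \<in> T" for s t
    using that is_tiling_tile_le[OF T] is_tiling_tile_le[OF ref] by (metis map_le_trans)
  ultimately show ?thesis unfolding is_tiling_iff by auto
qed

text \<open>Serves to discard the tiles that two tilings share.\<close>

lemma is_tiling_restrict:
  assumes "is_tiling S F T" "T' \<subseteq> T"
  shows "is_tiling S (F |` (\<Union>t\<in>T'. cells t)) T'"
proof -
  have "tile_figure t \<subseteq>\<^sub>m F |` (\<Union>t\<in>T'. cells t)" if "t \<in> T'" for t
  proof -
    have "tile_figure t \<subseteq>\<^sub>m F" using is_tiling_tile_le[OF assms(1)] that assms(2) by blast
    then show ?thesis using that unfolding map_le_def dom_tile_figure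
      by (auto simp: restrict_map_def)
  qed
  moreover have "finite T'" "fst ` T' \<subseteq> S"
    "\<forall>s\<in>T'. \<forall>t\<in>T'. s \<noteq> t \<longrightarrow> cells s \<inter> cells t = {}"
    using assms(2) finite_subset[OF _ is_tiling_finite[OF assms(1)]] is_tiling_arrays[OF assms(1)]
      is_tiling_disjoint[OF assms(1)] by blast+
  moreover have "dom (F |` (\<Union>t\<in>T'. cells t)) = (\<Union>t\<in>T'. cells t)"
    using assms(2) is_tiling_cells_subset[OF assms(1)] unfolding dom_restrict by blast
  ultimately show ?thesis unfolding is_tiling_iff by simp
qed

section \<open>Arrays and vertical runs of cells read as words\<close>

text \<open>A letter of this word is a whole row cut to length \<open>n\<close>, so the length of
  the word is the height of the array.\<close>

definition prefix_rows :: "nat \<Rightarrow> 'a mat \<Rightarrow> 'a list list" where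
  "prefix_rows n M = map (\<lambda>i. map (\<lambda>j. M $$ (i, j)) [0..<n]) [0..<dim_row M]"

definition figure_rows :: "'a figure \<Rightarrow> int \<Rightarrow> int \<Rightarrow> nat \<Rightarrow> nat \<Rightarrow> nat \<Rightarrow> 'a list list" where
  "figure_rows F r c n k h = map (\<lambda>i. map (\<lambda>j. the (F (r + int i, c + int j))) [0..<n]) [k..<h]"

lemma figure_rows_split:
  assumes "is_tiling S F T" "(M, (r + int k, c)) \<in> T" "k + dim_row M \<le> h" "n \<le> dim_col M"
  shows "figure_rows F r c n k h = prefix_rows n M @ figure_rows F r c n (k + dim_row M) h"
proof -
  have "[k..<h] = map (\<lambda>i. i + k) [0..<dim_row M] @ [k + dim_row M..<h]"
    using assms(3) upt_add_eq_append[of k "k + dim_row M" "h - (k + dim_row M)"]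
    by (simp add: map_add_upt add.commute)
  moreover have "map (\<lambda>i. map (\<lambda>j. the (F (r + int i, c + int j))) [0..<n]) (map (\<lambda>i. i + k) [0..<dim_row M])
     = prefix_rows n M"
    using is_tiling_label[OF assms(1,2)] assms(4)
    by (auto simp: prefix_rows_def add.assoc add.commute algebra_simps)
  ultimately show ?thesis by (simp add: figure_rows_def)
qed

text \<open>No cell lies left of column \<open>c\<close>, so every tile meeting the run starts in
  that column. These tiles are stacked without gaps, and each has at least \<open>n\<close> columns,
  so each contributes exactly its word \<open>prefix_rows n\<close>.\<close>

lemma figure_rows_factorization:
  assumes T: "is_tiling S F T"
    and ne: "\<And>M. M \<in> S \<Longrightarrow> nonempty_array M"
    and n: "\<And>M. M \<in> S \<Longrightarrow> n \<le> dim_col M"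
    and left: "\<And>x y. (x, y) \<in> dom F \<Longrightarrow> c \<le> y"
    and run: "\<And>k. k < h \<Longrightarrow> (r + int k, c) \<in> dom F"
    and stop: "(r + int h, c) \<notin> dom F"
    and t: "(M, (r + int k, c)) \<in> T" and k: "k < h"
  shows "\<exists>Ms. set Ms \<subseteq> S \<and>
    figure_rows F r c n k h = concat (map (prefix_rows n) (M # Ms))"
  using t k
proof (induction "h - k" arbitrary: k M rule: less_induct)
  case less
  have inS: "fst t \<in> S" if "t \<in> T" for t using is_tiling_arrays[OF T] that by blast
  have M: "M \<in> S" "0 < dim_row M" "0 < dim_col M"
    using inS[OF less.prems(1)] ne by (auto simp: nonempty_array_def)
  \<comment> \<open>A tile reaching further would cover the cell just below the run, which is
    outside the figure.\<close>
  have le: "k + dim_row M \<le> h"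
  proof (rule ccontr)
    assume "\<not> ?thesis"
    then have "(r + int h, c) \<in> cells (M, (r + int k, c))"
      using less.prems M by (auto simp: mem_cells_iff)
    then show False using stop is_tiling_cells_subset[OF T less.prems(1)] by blast
  qed
  note split = figure_rows_split[OF T less.prems(1) le n[OF M(1)]]
  show ?case
  proof (cases "k + dim_row M = h")
    case True
    then show ?thesis using split by (intro exI[of _ "[]"]) (simp add: figure_rows_def)
  next
    case False
    define k' where "k' = k + dim_row M"
    have k': "k' < h" using False le k'_def by simp
    obtain N a b where N: "(N, (a, b)) \<in> T" "(r + int k', c) \<in> cells (N, (a, b))"
      using is_tiling_covers[OF T run[OF k']] by (metis prod_cases3)
    have Npos: "0 < dim_row N" "0 < dim_col N"
      using inS[OF N(1)] ne by (auto simp: nonempty_array_def)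
    have "(a, b) \<in> cells (N, (a, b))" using Npos by (simp add: mem_cells_iff)
    then have "c \<le> b" using is_tiling_cells_subset[OF T N(1)] left by blast
    then have b: "b = c" using N(2) by (simp add: mem_cells_iff)
    \<comment> \<open>If \<open>N\<close> started higher, it would share the cell just above with
      the last row of \<open>M\<close> and so equal \<open>M\<close>, which ends before row
      \<open>k'\<close>.\<close>
    have a: "a = r + int k'"
    proof (rule ccontr)
      assume "a \<noteq> r + int k'"
      then have "(r + int k' - 1, c) \<in> cells (N, (a, b))"
        using N(2) by (auto simp: mem_cells_iff)
      moreover have "(r + int k' - 1, c) \<in> cells (M, (r + int k, c))"
        using M by (simp add: mem_cells_iff k'_def)
      ultimately have "(N, (a, b)) = (M, (r + int k, c))"
        using is_tiling_disjoint[OF T N(1) less.prems(1)] by blast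
      then show False using N(2) by (simp add: mem_cells_iff k'_def)
    qed
    have "h - k' < h - k" using k' M by (simp add: k'_def)
    then obtain Ms where "set Ms \<subseteq> S"
      "figure_rows F r c n k' h = concat (map (prefix_rows n) (N # Ms))"
      using less.hyps[of k' N] N(1) a b k' by blast
    then show ?thesis using split inS[OF N(1)] by (intro exI[of _ "N # Ms"]) (simp add: k'_def)
  qed
qed

text \<open>The corner of the tile covering \<open>(r, c)\<close> belongs to the figure itself, so
  it can lie neither further left nor higher.\<close>

lemma leftmost_top_tile:
  assumes T: "is_tiling S F T"
    and ne: "\<And>M. M \<in> S \<Longrightarrow> nonempty_array M"
    and left: "\<And>x y. (x, y) \<in> dom F \<Longrightarrow> c \<le> y"
    and top: "\<And>x. (x, c) \<in> dom F \<Longrightarrow> r \<le> x"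
    and mem: "(r, c) \<in> dom F"
  obtains M where "(M, (r, c)) \<in> T"
proof -
  obtain M a b where M: "(M, (a, b)) \<in> T" "(r, c) \<in> cells (M, (a, b))"
    using is_tiling_covers[OF T mem] by (metis prod_cases3)
  have "nonempty_array M" using is_tiling_arrays[OF T] M(1) ne by force
  then have "(a, b) \<in> cells (M, (a, b))" by (simp add: mem_cells_iff nonempty_array_def)
  then have ab: "(a, b) \<in> dom F" using is_tiling_cells_subset[OF T M(1)] by blast
  then have "b = c" using left[OF ab] M(2) by (simp add: mem_cells_iff)
  moreover have "a = r" using top ab M(2) \<open>b = c\<close> by (force simp: mem_cells_iff)
  ultimately show ?thesis using M that by blast
qed

text \<open>Disjoint tilings cannot have the same tile at the extreme corner, so the run below it is
  factorized with different first factors.\<close>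

lemma disjoint_tilings_commute:
  assumes fin: "finite (dom F)" and A: "nonempty_array A" and B: "nonempty_array B"
    and U: "is_tiling {A, B} F U" and V: "is_tiling {A, B} F V"
    and disj: "U \<inter> V = {}" and ne: "dom F \<noteq> {}"
    and n: "n \<le> dim_col A" "n \<le> dim_col B"
  shows "(\<exists>p. (A, p) \<in> U \<and> (B, p) \<in> V \<or> (B, p) \<in> U \<and> (A, p) \<in> V) \<and>
    prefix_rows n A @ prefix_rows n B = prefix_rows n B @ prefix_rows n A"
proof -
  define c where "c = Min (snd ` dom F)"
  define r where "r = Min {x. (x, c) \<in> dom F}"
  have left: "c \<le> y" if "(x, y) \<in> dom F" for x y
    using that fin unfolding c_def by (metis Min_le finite_imageI image_eqI snd_conv)
  have "c \<in> snd ` dom F" unfolding c_def using fin ne by simp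
  then have col: "{x. (x, c) \<in> dom F} \<noteq> {}" by (simp add: image_iff) (metis prod.collapse)
  have "{x. (x, c) \<in> dom F} \<subseteq> fst ` dom F" by force
  then have fincol: "finite {x. (x, c) \<in> dom F}" using fin finite_subset by blast
  have top: "r \<le> x" if "(x, c) \<in> dom F" for x
    using that fincol unfolding r_def by simp
  have mem: "(r, c) \<in> dom F"
    using Min_in[OF fincol col] unfolding r_def by simp
  \<comment> \<open>Finiteness ends the run; the least such \<open>k\<close> is then taken as its
    length \<open>h\<close>.\<close>
  have "\<exists>k. (r + int k, c) \<notin> dom F"
  proof (rule ccontr)
    assume "\<not> ?thesis"
    then have "range (\<lambda>k. r + int k) \<subseteq> {x. (x, c) \<in> dom F}" by blast
    then have "finite (range (\<lambda>k. r + int k))" using fincol finite_subset by blast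
    moreover have "inj (\<lambda>k. r + int k)" by (simp add: inj_def)
    ultimately show False using finite_imageD infinite_UNIV_nat by blast
  qed
  then obtain h where stop: "(r + int h, c) \<notin> dom F"
    and run: "\<And>k. k < h \<Longrightarrow> (r + int k, c) \<in> dom F"
    using exists_least_iff[of "\<lambda>k. (r + int k, c) \<notin> dom F"] by blast
  have h: "0 < h" using stop mem by (cases h) auto
  have neS: "nonempty_array M" if "M \<in> {A, B}" for M using that A B by auto
  have nS: "n \<le> dim_col M" if "M \<in> {A, B}" for M using that n by auto
  obtain M where M: "(M, (r, c)) \<in> U"
    by (rule leftmost_top_tile[OF U neS left top mem])
  obtain N where N: "(N, (r, c)) \<in> V"
    by (rule leftmost_top_tile[OF V neS left top mem])
  have MN: "M \<in> {A, B}" "N \<in> {A, B}"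
    using is_tiling_arrays[OF U] is_tiling_arrays[OF V] M N by force+
  have "M \<noteq> N" using M N disj by blast
  have M0: "(M, (r + int 0, c)) \<in> U" and N0: "(N, (r + int 0, c)) \<in> V" using M N by auto
  have "\<exists>Ms. set Ms \<subseteq> {A, B} \<and>
      figure_rows F r c n 0 h = concat (map (prefix_rows n) (M # Ms))"
    by (rule figure_rows_factorization[OF U neS nS left run stop M0 h])
  then obtain Ms where Ms: "set Ms \<subseteq> {A, B}"
    "figure_rows F r c n 0 h = concat (map (prefix_rows n) (M # Ms))" by blast
  have "\<exists>Ms. set Ms \<subseteq> {A, B} \<and>
      figure_rows F r c n 0 h = concat (map (prefix_rows n) (N # Ms))"
    by (rule figure_rows_factorization[OF V neS nS left run stop N0 h])
  then obtain Ns where Ns: "set Ns \<subseteq> {A, B}"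
    "figure_rows F r c n 0 h = concat (map (prefix_rows n) (N # Ns))" by blast
  have AB: "{M, N} = {A, B}" using MN \<open>M \<noteq> N\<close> by auto
  have "prefix_rows n M @ prefix_rows n N = prefix_rows n N @ prefix_rows n M"
  proof (rule two_word_relation_commute)
    show "prefix_rows n M @ concat (map (prefix_rows n) Ms) =
      prefix_rows n N @ concat (map (prefix_rows n) Ns)"
      using Ms Ns by simp
    show "set (map (prefix_rows n) Ms) \<subseteq> {prefix_rows n M, prefix_rows n N}"
      "set (map (prefix_rows n) Ns) \<subseteq> {prefix_rows n M, prefix_rows n N}"
      using Ms(1) Ns(1) AB by auto
    show "prefix_rows n M \<noteq> []" "prefix_rows n N \<noteq> []"
      using neS MN by (auto simp: prefix_rows_def nonempty_array_def)
  qed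
  moreover have "(M = A \<and> N = B) \<or> (M = B \<and> N = A)" using MN \<open>M \<noteq> N\<close> by auto
  ultimately show ?thesis using M N by auto
qed

section \<open>From commuting words to a common vertical period\<close>

lemma prefix_rows_power:
  assumes "prefix_rows n M = concat (replicate p z)" "i < dim_row M" "j < n"
  shows "M $$ (i, j) = z ! (i mod length z) ! j"
proof -
  have len: "dim_row M = p * length z"
    using arg_cong[OF assms(1), of length]
    by (simp add: prefix_rows_def length_concat sum_list_replicate)
  have "M $$ (i, j) = prefix_rows n M ! i ! j" using assms(2,3) by (simp add: prefix_rows_def)
  then show ?thesis using assms len nth_concat_replicate by metis
qed

lemma commuting_prefix_rows_common_root:
  assumes A: "nonempty_array A" and B: "nonempty_array B" and n: "0 < n"
    and comm: "prefix_rows n A @ prefix_rows n B = prefix_rows n B @ prefix_rows n A"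
  obtains X p q where "nonempty_array X" "dim_col X = n" "0 < p" "0 < q"
    "dim_row A = p * dim_row X" "dim_row B = q * dim_row X"
    "\<And>i j. i < dim_row A \<Longrightarrow> j < n \<Longrightarrow> A $$ (i, j) = X $$ (i mod dim_row X, j)"
    "\<And>i j. i < dim_row B \<Longrightarrow> j < n \<Longrightarrow> B $$ (i, j) = X $$ (i mod dim_row X, j)"
proof -
  \<comment> \<open>Commuting words are powers of one word \<open>z\<close>, which is read back
    below as the array \<open>X\<close> with \<open>n\<close> columns.\<close>
  obtain p q z where z: "prefix_rows n A = concat (replicate p z)"
    "prefix_rows n B = concat (replicate q z)"
    using comm_append_are_replicate[OF comm] by metis
  have lenA: "dim_row A = p * length z" and lenB: "dim_row B = q * length z"
    using arg_cong[OF z(1), of length] arg_cong[OF z(2), of length]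
    by (simp_all add: prefix_rows_def length_concat sum_list_replicate)
  then have pos: "0 < p" "0 < q" "0 < length z"
    using A B unfolding nonempty_array_def by (metis mult_is_0 neq0_conv)+
  define X where "X = mat (length z) n (\<lambda>(i, j). z ! i ! j)"
  show ?thesis
  proof (rule that[of X p q])
    show "A $$ (i, j) = X $$ (i mod dim_row X, j)" if "i < dim_row A" "j < n" for i j
      using that prefix_rows_power[OF z(1)] pos by (simp add: X_def)
    show "B $$ (i, j) = X $$ (i mod dim_row X, j)" if "i < dim_row B" "j < n" for i j
      using that prefix_rows_power[OF z(2)] pos by (simp add: X_def)
  qed (use pos n lenA lenB in \<open>auto simp: X_def nonempty_array_def\<close>)
qed

section \<open>Dissecting a tile into stacked copies and a remainder\<close>

definition strip :: "'a mat \<Rightarrow> nat \<Rightarrow> int \<times> int \<Rightarrow> 'a placed_tile set" where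
  "strip X p = (\<lambda>(a, b). (\<lambda>k. (X, (a + int (k * dim_row X), b))) ` {..<p})"

lemma strip_disjoint:
  assumes "s \<in> strip X p (a, b)" "t \<in> strip X p (a, b)" "s \<noteq> t"
  shows "cells s \<inter> cells t = {}"
proof -
  obtain k l where kl: "s = (X, (a + int (k * dim_row X), b))" "t = (X, (a + int (l * dim_row X), b))"
    using assms by (auto simp: strip_def)
  have "k * dim_row X + dim_row X \<le> l * dim_row X \<or> l * dim_row X + dim_row X \<le> k * dim_row X"
    using assms(3) kl mult_le_mono1[of "Suc k" l "dim_row X"] mult_le_mono1[of "Suc l" k "dim_row X"]
    by (cases k l rule: linorder_cases) (auto simp: add.commute)
  then show ?thesis unfolding kl by (auto simp: mem_cells_iff simp del: of_nat_mult)
qed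

lemma cells_strip:
  assumes "0 < dim_row X"
  shows "(x, y) \<in> (\<Union>t\<in>strip X p (a, b). cells t) \<longleftrightarrow>
    a \<le> x \<and> x < a + int (p * dim_row X) \<and> b \<le> y \<and> y < b + int (dim_col X)"
proof
  assume "(x, y) \<in> (\<Union>t\<in>strip X p (a, b). cells t)"
  then obtain k where k: "k < p" "(x, y) \<in> cells (X, (a + int (k * dim_row X), b))"
    by (auto simp: strip_def)
  have "k * dim_row X + dim_row X \<le> p * dim_row X"
    using mult_le_mono1[of "Suc k" p "dim_row X"] k by (simp add: add.commute)
  then show "a \<le> x \<and> x < a + int (p * dim_row X) \<and> b \<le> y \<and> y < b + int (dim_col X)"
    using k(2) by (auto simp: mem_cells_iff simp del: of_nat_mult)
next
  assume *: "a \<le> x \<and> x < a + int (p * dim_row X) \<and> b \<le> y \<and> y < b + int (dim_col X)"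
  \<comment> \<open>Dividing the row offset by the height of \<open>X\<close> gives the number of
    the copy containing the cell.\<close>
  define i where "i = nat (x - a)"
  define k where "k = i div dim_row X"
  have x: "x = a + int i" "i < p * dim_row X" using * by (auto simp: i_def simp del: of_nat_mult)
  have "k < p" using x by (simp add: k_def less_mult_imp_div_less)
  have "k * dim_row X \<le> i" by (simp add: k_def)
  moreover have "i < k * dim_row X + dim_row X"
    using dividend_less_div_times[OF assms, of i] by (simp only: k_def add.commute)
  ultimately have "(x, y) \<in> cells (X, (a + int (k * dim_row X), b))"
    using * x by (simp add: mem_cells_iff del: of_nat_mult)
  then show "(x, y) \<in> (\<Union>t\<in>strip X p (a, b). cells t)"
    using \<open>k < p\<close> by (auto simp: strip_def)
qed

text \<open>\<open>M\<close> may be wider than \<open>X\<close>, so this covers both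
  \<open>A\<close>, which the strip fills, and \<open>B\<close>, where it fills only the left
  part.\<close>

lemma strip_labels:
  assumes "dim_row M = p * dim_row X" "dim_col X \<le> dim_col M"
    and per: "\<And>i j. i < dim_row M \<Longrightarrow> j < dim_col X \<Longrightarrow> M $$ (i, j) = X $$ (i mod dim_row X, j)"
    and "t \<in> strip X p (a, b)"
  shows "tile_figure t \<subseteq>\<^sub>m tile_figure (M, (a, b))"
proof -
  obtain k where k: "k < p" and t: "t = (X, (a + int (k * dim_row X), b))"
    using assms(4) by (auto simp: strip_def)
  show ?thesis
    unfolding t tile_figure_le_iff
  proof (intro allI impI)
    fix i j assume ij: "i < dim_row X" "j < dim_col X"
    define l where "l = k * dim_row X + i"
    have "l < dim_row M"
      using mult_le_mono1[of "Suc k" p "dim_row X"] k ij assms(1) by (simp add: l_def)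
    moreover have "l mod dim_row X = i" using ij by (simp add: l_def)
    ultimately have "tile_figure (M, (a, b)) (a + int l, b + int j) = Some (X $$ (i, j))"
      using ij assms(2) per[of l j] by (simp add: tile_figure_def)
    then show "tile_figure (M, (a, b)) (a + int (k * dim_row X) + int i, b + int j) = Some (X $$ (i, j))"
      by (simp add: l_def add.assoc)
  qed
qed

lemma is_tiling_strip:
  assumes "0 < dim_row X" "dim_row M = p * dim_row X" "dim_col X = dim_col M" "X \<in> S"
    and per: "\<And>i j. i < dim_row M \<Longrightarrow> j < dim_col X \<Longrightarrow> M $$ (i, j) = X $$ (i mod dim_row X, j)"
  shows "is_tiling S (tile_figure (M, (a, b))) (strip X p (a, b))"
proof -
  have "(\<Union>t\<in>strip X p (a, b). cells t) = cells (M, (a, b))"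
    by (intro Set.set_eqI)
      (metis assms(1-3) cells_strip mem_cells_iff prod.collapse)
  moreover have "finite (strip X p (a, b))" "fst ` strip X p (a, b) \<subseteq> S"
    using assms(4) by (auto simp: strip_def)
  ultimately show ?thesis
    unfolding is_tiling_iff dom_tile_figure
    using strip_disjoint strip_labels[OF assms(2) _ per] assms(3) by (metis order_refl)
qed

definition drop_cols :: "nat \<Rightarrow> 'a mat \<Rightarrow> 'a mat" where
  "drop_cols n M = mat (dim_row M) (dim_col M - n) (\<lambda>(i, j). M $$ (i, j + n))"

lemma is_tiling_strip_insert:
  assumes "0 < dim_row X" "dim_row M = p * dim_row X" "dim_col X = n" "n \<le> dim_col M"
    and "X \<in> S" "drop_cols n M \<in> S"
    and per: "\<And>i j. i < dim_row M \<Longrightarrow> j < dim_col X \<Longrightarrow> M $$ (i, j) = X $$ (i mod dim_row X, j)"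
  shows "is_tiling S (tile_figure (M, (a, b)))
    (insert (drop_cols n M, (a, b + int n)) (strip X p (a, b)))" (is "is_tiling _ _ (insert ?d ?T)")
proof -
  have cd: "(x, y) \<in> cells ?d \<longleftrightarrow>
      a \<le> x \<and> x < a + int (p * dim_row X) \<and> b + int n \<le> y \<and> y < b + int (dim_col M)" for x y
    using assms(2,4) by (auto simp: mem_cells_iff drop_cols_def simp del: of_nat_mult)
  have cover: "(\<Union>t\<in>insert ?d ?T. cells t) = cells (M, (a, b))"
  proof (intro Set.set_eqI, clarify)
    fix x y
    show "(x, y) \<in> (\<Union>t\<in>insert ?d ?T. cells t) \<longleftrightarrow> (x, y) \<in> cells (M, (a, b))"
      unfolding UN_insert Un_iff cd cells_strip[OF assms(1)] mem_cells_iff[of _ _ M]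
      using assms(2-4) by (auto simp del: of_nat_mult)
  qed
  have "cells ?d \<inter> (\<Union>t\<in>?T. cells t) = {}"
  proof -
    have "\<not> ((x, y) \<in> cells ?d \<and> (x, y) \<in> (\<Union>t\<in>?T. cells t))" for x y
      unfolding cd cells_strip[OF assms(1)] using assms(3) by simp
    then show ?thesis by auto
  qed
  then have disj: "\<forall>s\<in>insert ?d ?T. \<forall>t\<in>insert ?d ?T. s \<noteq> t \<longrightarrow> cells s \<inter> cells t = {}"
    using strip_disjoint by blast
  have "tile_figure ?d \<subseteq>\<^sub>m tile_figure (M, (a, b))"
    using assms(4) unfolding tile_figure_le_iff
    by (auto simp: drop_cols_def tile_figure_def nat_add_distrib algebra_simps)
  moreover have "tile_figure t \<subseteq>\<^sub>m tile_figure (M, (a, b))" if "t \<in> ?T" for t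
    using strip_labels[OF assms(2) _ per that] assms(3,4) by simp
  moreover have "finite (insert ?d ?T)" "fst ` insert ?d ?T \<subseteq> S"
    using assms(5,6) by (auto simp: strip_def)
  ultimately show ?thesis
    unfolding is_tiling_iff dom_tile_figure using cover disj by blast
qed

section \<open>Common roots and their extension\<close>

lemma eq_array_power_iff:
  "M = array_power C p q \<longleftrightarrow> dim_row M = p * dim_row C \<and> dim_col M = q * dim_col C \<and>
     (\<forall>i<dim_row M. \<forall>j<dim_col M. M $$ (i, j) = C $$ (i mod dim_row C, j mod dim_col C))"
  by (auto simp: array_power_def)

definition common_root :: "'a mat \<Rightarrow> 'a mat \<Rightarrow> bool" where
  "common_root A B \<longleftrightarrow> (\<exists>C p1 q1 p2 q2. nonempty_array C \<and> 0 < p1 \<and> 0 < q1 \<and> 0 < p2 \<and> 0 < q2 \<and>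
     A = array_power C p1 q1 \<and> B = array_power C p2 q2)"

lemma common_root_commute: "common_root A B \<Longrightarrow> common_root B A"
  unfolding common_root_def by blast

lemma common_root_refl: "nonempty_array A \<Longrightarrow> common_root A A"
  unfolding common_root_def
  by (intro exI[of _ A] exI[of _ 1]) (simp add: eq_array_power_iff)

text \<open>The height and width of \<open>X\<close> are multiples of those of \<open>C\<close>.
  Hence stacking copies of \<open>X\<close> keeps the vertical period of \<open>C\<close>, and
  appending \<open>drop_cols (dim_col X) B\<close> on the right keeps the horizontal one.\<close>

lemma common_root_extend:
  assumes root: "common_root X (drop_cols (dim_col X) B)"
    and dims: "0 < p" "dim_row A = p * dim_row X" "dim_col A = dim_col X" "dim_col X \<le> dim_col B"
    and A: "\<And>i j. i < dim_row A \<Longrightarrow> j < dim_col X \<Longrightarrow> A $$ (i, j) = X $$ (i mod dim_row X, j)"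
    and B: "\<And>i j. i < dim_row B \<Longrightarrow> j < dim_col X \<Longrightarrow> B $$ (i, j) = X $$ (i mod dim_row X, j)"
  shows "common_root A B"
proof -
  obtain C p1 q1 p2 q2 where C: "nonempty_array C" "0 < p1" "0 < q1" "0 < p2" "0 < q2"
    and X: "X = array_power C p1 q1" and D: "drop_cols (dim_col X) B = array_power C p2 q2"
    using root unfolding common_root_def by blast
  have Xd: "dim_row X = p1 * dim_row C" "dim_col X = q1 * dim_col C"
    and Xe: "\<And>i j. i < dim_row X \<Longrightarrow> j < dim_col X \<Longrightarrow> X $$ (i, j) = C $$ (i mod dim_row C, j mod dim_col C)"
    using X unfolding eq_array_power_iff by blast+
  have Bd: "dim_row B = p2 * dim_row C" "dim_col B - dim_col X = q2 * dim_col C"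
    and De: "\<And>i j. i < dim_row B \<Longrightarrow> j < dim_col B - dim_col X \<Longrightarrow>
      B $$ (i, j + dim_col X) = C $$ (i mod dim_row C, j mod dim_col C)"
    using D unfolding eq_array_power_iff drop_cols_def by auto
  have pos: "0 < dim_row X" using Xd C by (simp add: nonempty_array_def)
  have Xper: "X $$ (i mod dim_row X, j) = C $$ (i mod dim_row C, j mod dim_col C)"
    if "j < dim_col X" for i j
    using Xe[of "i mod dim_row X" j] that pos by (simp add: Xd(1) mod_mod_cancel)
  have "A = array_power C (p * p1) q1"
    unfolding eq_array_power_iff using dims A Xper Xd by simp
  \<comment> \<open>The left part of \<open>B\<close> is \<open>q1\<close> blocks wide and the
    remainder \<open>q2\<close>; the remainder has the full height of \<open>B\<close>, hence the
    factor \<open>p2\<close>.\<close>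
  moreover have "B = array_power C p2 (q1 + q2)"
    unfolding eq_array_power_iff
  proof (intro conjI allI impI)
    show "dim_row B = p2 * dim_row C" by (rule Bd(1))
    show "dim_col B = (q1 + q2) * dim_col C"
      using Bd(2) Xd(2) dims(4) by (simp add: algebra_simps)
    fix i j assume ij: "i < dim_row B" "j < dim_col B"
    show "B $$ (i, j) = C $$ (i mod dim_row C, j mod dim_col C)"
    proof (cases "j < dim_col X")
      case True
      then show ?thesis using B Xper ij by simp
    next
      case False
      then obtain l where l: "j = l + dim_col X" by (metis add.commute le_Suc_ex not_less)
      then have "B $$ (i, j) = C $$ (i mod dim_row C, l mod dim_col C)" using De ij by simp
      then show ?thesis by (simp add: l Xd(2))
    qed
  qed
  ultimately show ?thesis
    unfolding common_root_def using C dims(1) by (metis add_pos_pos mult_pos_pos)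
qed

section \<open>The induction on total width\<close>

text \<open>A tile of \<open>V\<close> that meets a tile of \<open>U - V\<close> cannot lie in
  \<open>U\<close>, by disjointness within \<open>U\<close>. So after the common tiles are removed,
  the rest still tile one and the same figure.\<close>

lemma cells_diff_eq:
  assumes U: "is_tiling S F U" and V: "is_tiling S F V"
  shows "(\<Union>t\<in>U - V. cells t) = (\<Union>t\<in>V - U. cells t)"
proof -
  have "(\<Union>t\<in>U - V. cells t) \<subseteq> (\<Union>t\<in>V - U. cells t)"
    if U: "is_tiling S F U" and V: "is_tiling S F V" for U V
  proof
    fix c assume "c \<in> (\<Union>t\<in>U - V. cells t)"
    then obtain t where t: "t \<in> U" "t \<notin> V" "c \<in> cells t" by blast
    then obtain s where s: "s \<in> V" "c \<in> cells s"
      using is_tiling_covers[OF V] is_tiling_cells_subset[OF U] by blast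
    then have "s \<notin> U" using is_tiling_disjoint[OF U] t by blast
    then show "c \<in> (\<Union>t\<in>V - U. cells t)" using s by blast
  qed
  then show ?thesis using U V by blast
qed

text \<open>The induction hypothesis is a premise here, so that the step can be used with
  \<open>A\<close> and \<open>B\<close> exchanged.\<close>

lemma common_root_step:
  fixes A B :: "'a mat"
  assumes IH: "\<And>(X :: 'a mat) D F U V. dim_col X + dim_col D < dim_col A + dim_col B \<Longrightarrow>
      nonempty_array X \<Longrightarrow> nonempty_array D \<Longrightarrow> finite (dom F) \<Longrightarrow>
      is_tiling {X, D} F U \<Longrightarrow> is_tiling {X, D} F V \<Longrightarrow> U \<noteq> V \<Longrightarrow> common_root X D"
    and A: "nonempty_array A" and B: "nonempty_array B" and AB: "A \<noteq> B"
    and le: "dim_col A \<le> dim_col B" and fin: "finite (dom F)"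
    and U: "is_tiling {A, B} F U" and V: "is_tiling {A, B} F V" and UV: "U \<noteq> V"
  shows "common_root A B"
proof -
  define n where "n = dim_col A"
  define F' where "F' = F |` (\<Union>t\<in>U - V. cells t)"
  have fin': "finite (dom F')" using fin by (simp add: F'_def)
  have U': "is_tiling {A, B} F' (U - V)"
    unfolding F'_def by (rule is_tiling_restrict[OF U]) blast
  have V': "is_tiling {A, B} F' (V - U)"
    unfolding F'_def cells_diff_eq[OF U V] by (rule is_tiling_restrict[OF V]) blast
  have corner: "P \<in> cells (M, P)" if "M \<in> {A, B}" for M P
    using that A B by (cases P) (auto simp: mem_cells_iff nonempty_array_def)
  have "dom F' \<noteq> {}"
  proof -
    obtain M P where M: "(M, P) \<in> (U - V) \<union> (V - U)" using UV by fast
    then have "M \<in> {A, B}" using is_tiling_arrays[OF U] is_tiling_arrays[OF V] by force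
    then show ?thesis
      using corner[of M P] M is_tiling_cells_subset[OF U'] is_tiling_cells_subset[OF V'] by blast
  qed
  then obtain P where P: "(A, P) \<in> U - V \<and> (B, P) \<in> V - U \<or> (B, P) \<in> U - V \<and> (A, P) \<in> V - U"
    and comm: "prefix_rows n A @ prefix_rows n B = prefix_rows n B @ prefix_rows n A"
    using disjoint_tilings_commute[OF fin' A B U' V', of n] le by (auto simp: n_def)
  have "0 < n" using A by (simp add: n_def nonempty_array_def)
  then obtain X p q where X: "nonempty_array X" "dim_col X = n" "0 < p" "0 < q"
    "dim_row A = p * dim_row X" "dim_row B = q * dim_row X"
    and XA: "\<And>i j. i < dim_row A \<Longrightarrow> j < n \<Longrightarrow> A $$ (i, j) = X $$ (i mod dim_row X, j)"
    and XB: "\<And>i j. i < dim_row B \<Longrightarrow> j < n \<Longrightarrow> B $$ (i, j) = X $$ (i mod dim_row X, j)"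
    using commuting_prefix_rows_common_root[OF A B _ comm] by blast
  show ?thesis
  proof (cases "dim_col B = n")
    \<comment> \<open>Equal widths leave no remainder: \<open>X\<close> itself is the common
      root.\<close>
    case True
    have "A = array_power X p 1" "B = array_power X q 1"
      unfolding eq_array_power_iff using X XA XB True by (simp_all add: n_def)
    then show ?thesis unfolding common_root_def using X by (metis less_numeral_extra(1))
  next
    case False
    define D where "D = drop_cols n B"
    have D: "nonempty_array D" "dim_col D = dim_col B - n"
      using False le B by (auto simp: D_def drop_cols_def nonempty_array_def n_def)
    have Xrow: "0 < dim_row X" using X by (simp add: nonempty_array_def)
    have "common_root X D"
    \<comment> \<open>If \<open>X = D\<close>, copies of \<open>D\<close> could not be told apart
      from copies in the strips, so the two refined tilings might coincide.\<close>
    proof (cases "X = D")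
      case True
      then show ?thesis using common_root_refl X by blast
    next
      case XD: False
      define R where "R = (\<lambda>(M, a, b). if M = A then strip X p (a, b)
        else insert (D, (a, b + int n)) (strip X q (a, b)))"
      have R: "is_tiling {X, D} (tile_figure t) (R t)" if "fst t \<in> {A, B}" for t
      proof -
        obtain M a b where t: "t = (M, (a, b))" by (metis prod_cases3)
        show ?thesis
        proof (cases "M = A")
          case True
          then show ?thesis
            using is_tiling_strip[of X A p "{X, D}" a b] Xrow X XA by (simp add: t R_def n_def)
        next
          case False
          then have "M = B" using that t by simp
          then show ?thesis
            using is_tiling_strip_insert[of X B q n "{X, D}" a b] Xrow X XB le False
            by (simp add: t R_def n_def D_def)
        qed
      qed
      \<comment> \<open>Since \<open>X \<noteq> D\<close>, a copy of \<open>D\<close> arises only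
        from a tile \<open>B\<close>, and shifting it left by \<open>n\<close> columns recovers the
        position of that tile.\<close>
      have mem: "(D, (a, b + int n)) \<in> (\<Union>t\<in>T. R t) \<longleftrightarrow> (B, (a, b)) \<in> T"
        if "fst ` T \<subseteq> {A, B}" for T a b
      proof
        assume "(D, (a, b + int n)) \<in> (\<Union>t\<in>T. R t)"
        then obtain M a' b' where M: "(M, (a', b')) \<in> T" "(D, (a, b + int n)) \<in> R (M, (a', b'))"
          by auto
        then have "M \<noteq> A" "a' = a" "b' = b" using XD by (auto simp: R_def strip_def split: if_splits)
        moreover have "M \<in> {A, B}" using M(1) that by force
        ultimately show "(B, (a, b)) \<in> T" using M(1) by simp
      next
        assume "(B, (a, b)) \<in> T"
        moreover have "(D, (a, b + int n)) \<in> R (B, (a, b))" using AB by (simp add: R_def)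
        ultimately show "(D, (a, b + int n)) \<in> (\<Union>t\<in>T. R t)" by blast
      qed
      have fU: "fst ` (U - V) \<subseteq> {A, B}" and fV: "fst ` (V - U) \<subseteq> {A, B}"
        by (rule is_tiling_arrays[OF U'], rule is_tiling_arrays[OF V'])
      obtain a b where ab: "P = (a, b)" by (cases P)
      have one: "\<not> ((A, P) \<in> T \<and> (B, P) \<in> T)" if "is_tiling {A, B} F' T" for T
        using is_tiling_disjoint[OF that, of "(A, P)" "(B, P)" P] corner AB by auto
      \<comment> \<open>At \<open>P\<close> one tiling has \<open>A\<close> and the other
        \<open>B\<close>; the one with \<open>A\<close> cannot have \<open>B\<close> there too, as
        both would cover \<open>P\<close>.\<close>
      have "(B, (a, b)) \<in> U - V \<longleftrightarrow> (B, (a, b)) \<notin> V - U"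
        using P one[OF U'] one[OF V'] ab by blast
      then have "(\<Union>t\<in>U - V. R t) \<noteq> (\<Union>t\<in>V - U. R t)"
        using mem[OF fU, of a b] mem[OF fV, of a b] by metis
      moreover have "is_tiling {X, D} F' (\<Union>t\<in>U - V. R t)"
        using fU by (intro is_tiling_refine[OF U'] R) auto
      moreover have "is_tiling {X, D} F' (\<Union>t\<in>V - U. R t)"
        using fV by (intro is_tiling_refine[OF V'] R) auto
      \<comment> \<open>The new total width is just that of \<open>B\<close>, and \<open>A\<close>
        has positive width.\<close>
      moreover have "dim_col X + dim_col D < dim_col A + dim_col B"
        using X(2) D(2) le \<open>0 < n\<close> by (simp add: n_def)
      ultimately show ?thesis using IH[OF _ X(1) D(1) fin'] by blast
    qed
    then have "common_root X (drop_cols (dim_col X) B)" using X(2) by (simp add: D_def)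
    then show ?thesis
    proof (rule common_root_extend)
      show "dim_col A = dim_col X" "dim_col X \<le> dim_col B" using X(2) le by (simp_all add: n_def)
      show "A $$ (i, j) = X $$ (i mod dim_row X, j)" if "i < dim_row A" "j < dim_col X" for i j
        using XA that X(2) by simp
      show "B $$ (i, j) = X $$ (i mod dim_row X, j)" if "i < dim_row B" "j < dim_col X" for i j
        using XB that X(2) by simp
    qed (use X in auto)
  qed
qed

lemma two_tilings_common_root:
  assumes "nonempty_array A" "nonempty_array B" "finite (dom F)"
    and "is_tiling {A, B} F U" "is_tiling {A, B} F V" "U \<noteq> V"
  shows "common_root A B"
  using assms
proof (induction "dim_col A + dim_col B" arbitrary: A B F U V rule: less_induct)
  case less
  show ?case
  proof (cases "A = B")
    case True
    then show ?thesis using common_root_refl less.prems by blast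
  next
    case False
    show ?thesis
    proof (cases "dim_col A \<le> dim_col B")
      case True
      show ?thesis
        by (rule common_root_step[OF less.hyps less.prems(1,2) \<open>A \<noteq> B\<close> True less.prems(3-6)])
    next
      case le: False
      \<comment> \<open>The step expects the narrower array first, so the roles are
        exchanged.\<close>
      have "common_root B A"
      proof (rule common_root_step)
        show "is_tiling {B, A} F U" "is_tiling {B, A} F V"
          using less.prems by (simp_all add: insert_commute)
        show "common_root X D" if "dim_col X + dim_col D < dim_col B + dim_col A"
          "nonempty_array X" "nonempty_array D" "finite (dom F)"
          "is_tiling {X, D} F U" "is_tiling {X, D} F V" "U \<noteq> V" for X D :: "'a mat" and F U V
          using less.hyps[of X D F U V] that by (simp add: add.commute)
      qed (use less.prems False le in auto)
      then show ?thesis by (rule common_root_commute)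
    qed
  qed
qed

theorem theorem6:
  fixes F :: "('a::finite) figure" and A B :: "'a mat" and U V :: "'a placed_tile set"
  assumes "plane_figure F"
    and "nonempty_array A" and "nonempty_array B"
    and "is_tiling {A, B} F U" and "is_tiling {A, B} F V"
    and "U \<noteq> V"
  shows "\<exists>C p1 q1 p2 q2. nonempty_array C \<and> 0 < p1 \<and> 0 < q1 \<and> 0 < p2 \<and> 0 < q2 \<and>
           A = array_power C p1 q1 \<and> B = array_power C p2 q2"
  using two_tilings_common_root[of A B F U V] assms
  unfolding common_root_def plane_figure_def by blast

end
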